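(* Let $A\in\mathbb{R}^{N\times N}$ and $v\in\mathbb{R}^N$. Let $\widehat{\omega}=\frac{N}{\mathbb{E}[T]}\omega$, where $\omega\in\mathbb{R}$ is the scalar parameter associated with a convergent classical Richardson iteration for $Az=v$. Let $\widehat{z}_m$ be the $m$th iterate generated by the straggler-tolerant Richardson iteration $$\widehat{z}_i=(I-\widehat{\omega}D_{{\cal T}_i}A)\widehat{z}_{i-1}+\omega v,\qquad i=1,2,\ldots,$$ with $\widehat{z}_0=f$ for some $f\in\mathbb{R}^N$. Then $$\lim_{m\rightarrow\infty}\mathbb{E}\left[\widehat{z}_m\right]=z,$$ where $z$ is the solution of the linear system $Az=v$.
   Context: $T$ is a random integer with an arbitrary distribution on $\{1,\ldots,N\}$, and ${\cal T}$ is a random subset of $\{1,\ldots,N\}$ with $|{\cal T}|=T$ such that, conditionally on $T=t$, each of the $\binom{N}{t}$ subsets of cardinality $t$ is chosen with probability $\binom{N}{t}^{-1}$. The pairs $(T_1,{\cal T}_1),(T_2,{\cal T}_2),\ldots$ are independent and identically distributed copies of $(T,{\cal T})$. $I$ is the $N\times N$ identity matrix, $e_j$ is its $j$th column, and $D_{{\cal T}_i}=\sum_{j\in{\cal T}_i}e_je_j^{\top}$. The data $A,v,\omega,f$ are deterministic. The classical Richardson iteration with parameter $\omega$ is $z_i=(I-\omega A)z_{i-1}+\omega v$; it is convergent when $\rho(I-\omega A)<1$, where $\rho$ denotes the spectral radius. *)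

theory Defs
  imports "HOL-Probability.Probability" "Jordan_Normal_Form.Spectral_Radius"
begin

unbundle no vec_syntax

text \<open>Coordinates are numbered \<open>0, \<dots>, N - 1\<close>, as in the matrix library, instead of
  \<open>1, \<dots>, N\<close>. Cardinalities still range over \<open>{1..N}\<close>.\<close>

definition uniform_random_subset ::
  "'a measure \<Rightarrow> nat \<Rightarrow> ('a \<Rightarrow> nat) \<Rightarrow> ('a \<Rightarrow> nat set) \<Rightarrow> bool" where
  "uniform_random_subset M N T S \<longleftrightarrow>
     T \<in> measurable M (count_space {1..N}) \<and>
     S \<in> measurable M (count_space (Pow {..<N})) \<and>
     (\<forall>x\<in>space M. card (S x) = T x) \<and>
     (\<forall>t\<in>{1..N}. \<P>(x in M. T x = t) > 0 \<longrightarrow>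
        (\<forall>s. s \<subseteq> {..<N} \<and> card s = t \<longrightarrow>
           \<P>(x in M. S x = s \<bar> T x = t) = 1 / real (N choose t)))"

definition pair_space :: "nat \<Rightarrow> (nat \<times> nat set) measure" where
  "pair_space N = count_space ({1..N} \<times> Pow {..<N})"

definition iid_copies ::
  "'a measure \<Rightarrow> nat \<Rightarrow> ('a \<Rightarrow> nat) \<Rightarrow> ('a \<Rightarrow> nat set) \<Rightarrow>
    (nat \<Rightarrow> 'a \<Rightarrow> nat) \<Rightarrow> (nat \<Rightarrow> 'a \<Rightarrow> nat set) \<Rightarrow> bool" where
  "iid_copies M N T S Ts Ss \<longleftrightarrow>
     prob_space.indep_vars M (\<lambda>i. pair_space N) (\<lambda>i x. (Ts i x, Ss i x)) {1..} \<and>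
     (\<forall>i\<ge>1. distr M (pair_space N) (\<lambda>x. (Ts i x, Ss i x)) =
             distr M (pair_space N) (\<lambda>x. (T x, S x)))"

text \<open>The entries of the sum of the outer products of \<open>unit_vec N j\<close> with itself, for \<open>j\<close> in \<open>S\<close>.\<close>
definition D_mat :: "nat \<Rightarrow> nat set \<Rightarrow> real mat" where
  "D_mat N S = mat N N (\<lambda>(r, c). \<Sum>j\<in>S. unit_vec N j $ r * unit_vec N j $ c)"

text \<open>The two parameters are distinct: \<open>\<omega>h\<close> scales the matrix term, \<open>\<omega>\<close> the right-hand side.\<close>
primrec straggler_richardson ::
  "nat \<Rightarrow> real mat \<Rightarrow> real vec \<Rightarrow> real \<Rightarrow> real \<Rightarrow> real vec \<Rightarrow> (nat \<Rightarrow> nat set) \<Rightarrow> nat \<Rightarrow> real vec" where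
  "straggler_richardson N A v \<omega>h \<omega> f Ss 0 = f"
| "straggler_richardson N A v \<omega>h \<omega> f Ss (Suc i) =
     (1\<^sub>m N - \<omega>h \<cdot>\<^sub>m (D_mat N (Ss (Suc i)) * A)) *\<^sub>v straggler_richardson N A v \<omega>h \<omega> f Ss i
       + \<omega> \<cdot>\<^sub>v v"

definition richardson_convergent :: "nat \<Rightarrow> real mat \<Rightarrow> real \<Rightarrow> bool" where
  "richardson_convergent N A \<omega> \<longleftrightarrow>
     spectral_radius (map_mat complex_of_real (1\<^sub>m N - \<omega> \<cdot>\<^sub>m A)) < 1"

definition expectation_vec :: "'a measure \<Rightarrow> nat \<Rightarrow> ('a \<Rightarrow> real vec) \<Rightarrow> real vec" where
  "expectation_vec M N X = vec N (\<lambda>j. \<integral>x. X x $ j \<partial>M)"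

text \<open>The type of vectors carries no topology; convergence in \<open>carrier_vec N\<close> is coordinatewise.\<close>
definition vec_tendsto :: "nat \<Rightarrow> (nat \<Rightarrow> real vec) \<Rightarrow> real vec \<Rightarrow> bool" where
  "vec_tendsto N X z \<longleftrightarrow> (\<forall>j<N. (\<lambda>m. X m $ j) \<longlonglongrightarrow> z $ j)"

end

theory Submission
  imports Defs
begin

text \<open>
  The point is that the expected iterates satisfy the classical Richardson iteration with
  parameter \<open>\<omega>\<close> exactly. Write \<open>z m\<close> for the random iterate. Coordinate \<open>j\<close> of the next iterate is
  \<open>z m j - \<omega>h * I * (A z m) j + \<omega> * v j\<close>, where \<open>I\<close> indicates whether \<open>j\<close> belongs to the next random
  set. Three facts turn this into a recurrence for the expectations.

  First, the next random set is independent of the sets drawn so far, and \<open>z m\<close> depends only on the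
  latter, so the expectation of the product factors (\<open>straggler_richardson_indep_next_subset\<close>).
  Second, \<open>I\<close> has mean \<open>E[T] / N\<close>, by symmetry among the coordinates
  (\<open>uniform_random_subset_prob_mem\<close>). Third, \<open>\<omega>h\<close> times this mean is \<open>\<omega>\<close>. Hence
  \<open>E[z (m + 1)] = (1 - \<omega> A) E[z m] + \<omega> v\<close> (\<open>expectation_straggler_richardson_Suc\<close>).

  It remains to see that the classical iteration converges. Because the spectral radius of
  \<open>1 - \<omega> A\<close> is below \<open>1\<close>, the powers of this matrix tend to zero
  (\<open>pow_mat_tendsto_zero_if_spectral_radius_less_1\<close>). This forces \<open>A\<close> to be invertible
  (\<open>richardson_convergent_imp_unique_solution\<close>) and drives the error \<open>(1 - \<omega> A) ^ m (f - z)\<close> to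
  zero (\<open>richardson_tendsto_solution\<close>), where \<open>z\<close> is the solution of \<open>A z = v\<close>.
\<close>

section \<open>Convergence of the classical Richardson iteration\<close>

lemma pow_mat_smult:
  fixes A :: "'a :: comm_semiring_1 mat"
  assumes "A \<in> carrier_mat n n"
  shows "(c \<cdot>\<^sub>m A) ^\<^sub>m k = c ^ k \<cdot>\<^sub>m (A ^\<^sub>m k)"
proof (induction k)
  case 0
  show ?case by (rule eq_matI) auto
next
  case (Suc k)
  have Ak: "A ^\<^sub>m k \<in> carrier_mat n n" using assms by simp
  show ?case
    using assms Ak mult_smult_assoc_mat[OF Ak, of "c \<cdot>\<^sub>m A" n "c ^ k"] mult_smult_distrib[OF Ak assms, of c]
    by (auto simp: Suc ac_simps intro!: eq_matI)
qed

text \<open>A spectral radius below \<open>1\<close> bounds the powers of \<open>A\<close>, but boundedness alone does not give decay. The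
strict inequality leaves room for a factor \<open>c\<close> strictly between the spectral radius and \<open>1\<close>:
the matrix \<open>B = A / c\<close> still has spectral radius below \<open>1\<close>, hence bounded powers, and
\<open>A ^ k = c ^ k B ^ k\<close> decays geometrically.\<close>

lemma pow_mat_tendsto_zero_if_spectral_radius_less_1:
  fixes A :: "complex mat"
  assumes A: "A \<in> carrier_mat n n" and sr: "spectral_radius A < 1" and ij: "i < n" "j < n"
  shows "(\<lambda>k. (A ^\<^sub>m k) $$ (i, j)) \<longlonglongrightarrow> 0"
proof -
  have n: "n > 0" using ij by simp
  have sr0: "spectral_radius A \<ge> 0"
    using spectral_radius_mem_max(1)[OF A n] by auto
  define c where "c = (1 + spectral_radius A) / 2"
  have c: "0 < c" "c < 1" "spectral_radius A < c"
    using sr sr0 by (auto simp: c_def)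
  define B where "B = complex_of_real (1 / c) \<cdot>\<^sub>m A"
  have B: "B \<in> carrier_mat n n" using A by (simp add: B_def)
  have AB: "A = complex_of_real c \<cdot>\<^sub>m B"
    using c by (auto simp: B_def intro!: eq_matI)
  have "spectral_radius B < 1"
  proof -
    obtain e where e: "e \<in> spectrum B" "spectral_radius B = norm e"
      using spectral_radius_mem_max(1)[OF B n] by auto
    then obtain x where x: "x \<in> carrier_vec n" "x \<noteq> 0\<^sub>v n" "B *\<^sub>v x = e \<cdot>\<^sub>v x"
      using B by (auto simp: spectrum_def eigenvalue_def eigenvector_def)
    have "A *\<^sub>v x = complex_of_real c \<cdot>\<^sub>v (B *\<^sub>v x)"
      using B x(1) by (auto simp: AB scalar_prod_def sum_distrib_left mult.assoc intro!: eq_vecI)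
    then have "eigenvector A x (complex_of_real c * e)"
      using x A by (auto simp: eigenvector_def smult_smult_assoc)
    then have "complex_of_real c * e \<in> spectrum A"
      by (auto simp: spectrum_def eigenvalue_def)
    then have "norm (complex_of_real c * e) \<le> spectral_radius A"
      by (intro spectral_radius_mem_max(2)[OF A n]) auto
    then have "c * norm e \<le> spectral_radius A"
      using c by (simp add: norm_mult)
    then have "c * norm e < c * 1"
      using c(3) by linarith
    then show ?thesis
      unfolding e(2) using c(1) by (simp only: mult_less_cancel_left_pos)
  qed
  then obtain b where b: "\<And>k. norm_bound (B ^\<^sub>m k) b"
    using spectral_radius_jnf_norm_bound_less_1_upper_triangular[OF B] by blast
  have bound: "norm ((A ^\<^sub>m k) $$ (i, j)) \<le> c ^ k * b" for k
  proof -
    have Bk: "B ^\<^sub>m k \<in> carrier_mat n n" using B by simp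
    have "(A ^\<^sub>m k) $$ (i, j) = complex_of_real c ^ k * (B ^\<^sub>m k) $$ (i, j)"
      using carrier_matD[OF Bk] ij by (simp add: AB pow_mat_smult[OF B])
    moreover have "norm ((B ^\<^sub>m k) $$ (i, j)) \<le> b"
      using b[of k] carrier_matD[OF Bk] ij by (auto simp: norm_bound_def)
    ultimately show ?thesis
      using c by (simp add: norm_mult norm_power mult_left_mono)
  qed
  then have dominated: "\<forall>\<^sub>F k in sequentially. norm ((A ^\<^sub>m k) $$ (i, j)) \<le> c ^ k * b"
    by simp
  have "(\<lambda>k. c ^ k * b) \<longlonglongrightarrow> 0"
    using c by (intro tendsto_mult_left_zero LIMSEQ_power_zero) auto
  then show ?thesis
    by (rule Lim_null_comparison[OF dominated])
qed

lemma richardson_convergent_pow_tendsto_zero: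
  assumes A: "A \<in> carrier_mat N N" and conv: "richardson_convergent N A \<omega>"
    and ij: "i < N" "j < N"
  shows "(\<lambda>k. ((1\<^sub>m N - \<omega> \<cdot>\<^sub>m A) ^\<^sub>m k) $$ (i, j)) \<longlonglongrightarrow> 0"
proof -
  define B where "B = 1\<^sub>m N - \<omega> \<cdot>\<^sub>m A"
  have B: "B \<in> carrier_mat N N" using A by (simp add: B_def minus_carrier_mat)
  have Bk: "B ^\<^sub>m k \<in> carrier_mat N N" for k using B by simp
  have BC: "map_mat complex_of_real B \<in> carrier_mat N N" using B by simp
  have "(\<lambda>k. (map_mat complex_of_real B ^\<^sub>m k) $$ (i, j)) \<longlonglongrightarrow> 0"
    using conv pow_mat_tendsto_zero_if_spectral_radius_less_1[OF BC _ ij]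
    by (simp add: richardson_convergent_def B_def)
  moreover have "(map_mat complex_of_real B ^\<^sub>m k) $$ (i, j) = complex_of_real ((B ^\<^sub>m k) $$ (i, j))" for k
    using ij carrier_matD[OF Bk[of k]] by (simp flip: of_real_hom.mat_hom_pow[OF B])
  ultimately have "(\<lambda>k. complex_of_real ((B ^\<^sub>m k) $$ (i, j))) \<longlonglongrightarrow> complex_of_real 0" by simp
  then show ?thesis
    unfolding tendsto_of_real_iff B_def .
qed

text \<open>Since \<open>B ^ Suc m\<close> is \<open>B ^ m * B\<close>, the induction peels off the first step of the recurrence
rather than the last, that is, it applies the hypothesis to the shifted sequence.\<close>

lemma linear_recurrence_eq_pow_mat:
  fixes B :: "'a :: comm_semiring_1 mat"
  assumes B: "B \<in> carrier_mat n n" and "u 0 \<in> carrier_vec n"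
    and "\<And>m. u (Suc m) = B *\<^sub>v u m"
  shows "u m = (B ^\<^sub>m m) *\<^sub>v u 0"
  using assms(2,3)
proof (induction m arbitrary: u)
  case 0
  then show ?case using B by simp
next
  case (Suc m)
  have "u (Suc m) = (B ^\<^sub>m m) *\<^sub>v u (Suc 0)"
    by (rule Suc.IH[of "\<lambda>i. u (Suc i)"]) (use B Suc.prems in auto)
  then show ?case
    using B Suc.prems by (simp add: assoc_mult_mat_vec[of _ n n _ n])
qed

lemma richardson_error_tendsto_zero:
  assumes A: "A \<in> carrier_mat N N" and conv: "richardson_convergent N A \<omega>"
    and u0: "u 0 \<in> carrier_vec N"
    and step: "\<And>m. u (Suc m) = (1\<^sub>m N - \<omega> \<cdot>\<^sub>m A) *\<^sub>v u m" and j: "j < N"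
  shows "(\<lambda>m. u m $ j) \<longlonglongrightarrow> 0"
proof -
  let ?B = "1\<^sub>m N - \<omega> \<cdot>\<^sub>m A"
  have B: "?B \<in> carrier_mat N N" using A by (simp add: minus_carrier_mat)
  have "u m $ j = (\<Sum>i<N. (?B ^\<^sub>m m) $$ (j, i) * u 0 $ i)" for m
  proof -
    have "u m = (?B ^\<^sub>m m) *\<^sub>v u 0"
      by (rule linear_recurrence_eq_pow_mat[OF B u0 step])
    moreover have "dim_row (?B ^\<^sub>m m) = N" "dim_col (?B ^\<^sub>m m) = N"
      using pow_carrier_mat[OF B, of m] by blast+
    moreover have "dim_vec (u 0) = N"
      using u0 by simp
    ultimately show ?thesis
      using j by (simp add: scalar_prod_def atLeast0LessThan del: pow_mat_dim_square)
  qed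
  moreover have "(\<lambda>m. \<Sum>i<N. (?B ^\<^sub>m m) $$ (j, i) * u 0 $ i) \<longlonglongrightarrow> (\<Sum>i<N. 0 * u 0 $ i)"
    by (intro tendsto_intros richardson_convergent_pow_tendsto_zero[OF A conv j]) auto
  ultimately show ?thesis by simp
qed

lemma richardson_matrix_mult_vec:
  fixes A :: "real mat"
  assumes A: "A \<in> carrier_mat N N" and x: "x \<in> carrier_vec N"
  shows "(1\<^sub>m N - \<omega> \<cdot>\<^sub>m A) *\<^sub>v x = x - \<omega> \<cdot>\<^sub>v (A *\<^sub>v x)"
proof -
  have "(\<omega> \<cdot>\<^sub>m A) *\<^sub>v x = \<omega> \<cdot>\<^sub>v (A *\<^sub>v x)"
    using A x by (auto simp: scalar_prod_def sum_distrib_left mult.assoc intro!: eq_vecI)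
  then show ?thesis
    using A x by (subst minus_mult_distrib_mat_vec[of _ N N]) auto
qed

text \<open>A kernel vector of \<open>A\<close> is a fixed point of \<open>1 - \<omega> A\<close>, so the constant sequence at that vector obeys
the error recurrence and must tend to zero. Hence \<open>A\<close> is injective, and being square it is
invertible.\<close>

lemma richardson_convergent_imp_unique_solution:
  assumes A: "A \<in> carrier_mat N N" and v: "v \<in> carrier_vec N"
    and conv: "richardson_convergent N A \<omega>"
  obtains z where "z \<in> carrier_vec N" "A *\<^sub>v z = v"
    "\<And>y. y \<in> carrier_vec N \<Longrightarrow> A *\<^sub>v y = v \<Longrightarrow> y = z"
proof -
  have ker: "x = 0\<^sub>v N" if x: "x \<in> carrier_vec N" and Ax: "A *\<^sub>v x = 0\<^sub>v N" for x
  proof (rule eq_vecI)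
    have fixed: "x = (1\<^sub>m N - \<omega> \<cdot>\<^sub>m A) *\<^sub>v x"
      using x by (auto simp: richardson_matrix_mult_vec[OF A x] Ax)
    fix j assume "j < dim_vec (0\<^sub>v N :: real vec)"
    then have j: "j < N" by simp
    have "(\<lambda>m::nat. x $ j) \<longlonglongrightarrow> 0"
      by (rule richardson_error_tendsto_zero[OF A conv x fixed j])
    then show "x $ j = 0\<^sub>v N $ j"
      using j by (simp add: LIMSEQ_const_iff)
  qed (use x in simp)
  have "det A \<noteq> 0"
    using ker by (auto simp: det_0_iff_vec_prod_zero[OF A])
  from det_non_zero_imp_unit[OF A this, of "()"]
  obtain B where B: "B \<in> carrier_mat N N" "B * A = 1\<^sub>m N" "A * B = 1\<^sub>m N"
    by (auto simp: Units_def ring_mat_def)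
  have "A *\<^sub>v (B *\<^sub>v v) = v"
    using A B v by (simp flip: assoc_mult_mat_vec[of A N N B N v])
  moreover have "y = B *\<^sub>v v" if "y \<in> carrier_vec N" "A *\<^sub>v y = v" for y
    using A B that(1) by (simp flip: that(2) assoc_mult_mat_vec[of B N N A N y])
  ultimately show ?thesis
    using that[of "B *\<^sub>v v"] B v by auto
qed

text \<open>The solution \<open>z\<close> is a fixed point of the affine iteration, so the error \<open>u m - z\<close> follows the
homogeneous recurrence.\<close>

lemma richardson_tendsto_solution:
  assumes A: "A \<in> carrier_mat N N" and conv: "richardson_convergent N A \<omega>"
    and u: "\<And>m. u m \<in> carrier_vec N" and z: "z \<in> carrier_vec N"
    and step: "\<And>m. u (Suc m) = (1\<^sub>m N - \<omega> \<cdot>\<^sub>m A) *\<^sub>v u m + \<omega> \<cdot>\<^sub>v (A *\<^sub>v z)"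
  shows "vec_tendsto N u z"
  unfolding vec_tendsto_def
proof (intro allI impI)
  fix j assume j: "j < N"
  have B: "1\<^sub>m N - \<omega> \<cdot>\<^sub>m A \<in> carrier_mat N N" using A by (simp add: minus_carrier_mat)
  have err: "u (Suc m) - z = (1\<^sub>m N - \<omega> \<cdot>\<^sub>m A) *\<^sub>v (u m - z)" for m
    unfolding step mult_minus_distrib_mat_vec[OF B u z] richardson_matrix_mult_vec[OF A z]
      using A B z u[of m] by (intro eq_vecI) auto
  have "(\<lambda>m. (u m - z) $ j) \<longlonglongrightarrow> 0"
    by (rule richardson_error_tendsto_zero[where u = "\<lambda>m. u m - z", OF A conv _ err j]) (use u z in simp)
  moreover have "(u m - z) $ j = u m $ j - z $ j" for m
    using u[of m] z j by simp
  ultimately show "(\<lambda>m. u m $ j) \<longlonglongrightarrow> z $ j"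
    by (simp add: LIM_zero_iff)
qed

section \<open>Inclusion probabilities of a uniform random subset\<close>

lemma measurable_count_space_Collect:
  assumes "X \<in> measurable M (count_space A)"
  shows "{x \<in> space M. P (X x)} \<in> sets M"
proof -
  have "X -` {a \<in> A. P a} \<inter> space M \<in> sets M"
    by (rule measurable_sets[OF assms]) auto
  also have "X -` {a \<in> A. P a} \<inter> space M = {x \<in> space M. P (X x)}"
    using measurable_space[OF assms] by auto
  finally show ?thesis .
qed

text \<open>The formula also holds when \<open>card s\<close> is a value that \<open>T\<close> attains with probability zero, where the
conditional probability carries no information: both sides vanish. The probability of a nonempty
set thus depends on its cardinality alone.\<close>

lemma (in prob_space) uniform_random_subset_prob_eq:
  assumes U: "uniform_random_subset M N T S"
    and s: "s \<subseteq> {..<N}" "s \<noteq> {}"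
  shows "prob {x \<in> space M. S x = s} =
    prob {x \<in> space M. T x = card s} / real (N choose card s)"
proof -
  have T: "T \<in> measurable M (count_space {1..N})"
    and card_S: "\<And>x. x \<in> space M \<Longrightarrow> card (S x) = T x"
    using U by (auto simp: uniform_random_subset_def)
  have fin: "finite s" using s(1) finite_subset by blast
  have t: "card s \<in> {1..N}"
    using s fin card_mono[OF _ s(1)] by (auto simp: Suc_le_eq card_gt_0_iff)
  have meas: "{x \<in> space M. T x = card s} \<in> events"
    by (rule measurable_count_space_Collect[OF T])
  have S_T: "{x \<in> space M. S x = s} = {x \<in> space M. S x = s \<and> T x = card s}"
    using card_S by auto
  show ?thesis
  proof (cases "prob {x \<in> space M. T x = card s} = 0")
    case True
    have "prob {x \<in> space M. S x = s} \<le> prob {x \<in> space M. T x = card s}"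
      by (rule finite_measure_mono[OF _ meas]) (use S_T in auto)
    then have "prob {x \<in> space M. S x = s} = 0"
      using True by (simp add: measure_le_0_iff)
    with True show ?thesis by simp
  next
    case False
    then have pos: "prob {x \<in> space M. T x = card s} > 0"
      by (simp add: zero_less_measure_iff)
    then have "\<P>(x in M. S x = s \<bar> T x = card s) = 1 / real (N choose card s)"
      using U t s(1) by (simp add: uniform_random_subset_def)
    then show ?thesis
      using pos by (simp add: cond_prob_def S_T field_simps)
  qed
qed

text \<open>The transposition of \<open>j\<close> and \<open>k\<close> exchanges the subsets that contain \<open>j\<close> with those that contain
\<open>k\<close> and preserves cardinalities.\<close>

lemma sum_subsets_containing_card_eq:
  fixes g :: "nat \<Rightarrow> real"
  assumes "j < N" "k < N"
  shows "(\<Sum>s | s \<subseteq> {..<N} \<and> j \<in> s. g (card s)) = (\<Sum>s | s \<subseteq> {..<N} \<and> k \<in> s. g (card s))"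
proof -
  let ?\<tau> = "\<lambda>s. Transposition.transpose j k ` s"
  have card_\<tau>: "card (?\<tau> s) = card s" for s
    by (rule card_image) (auto intro: inj_on_subset[OF inj_transpose])
  have sub: "?\<tau> s \<subseteq> {..<N}" if "s \<subseteq> {..<N}" for s
    using that assms by (auto simp: Transposition.transpose_def)
  have inv: "?\<tau> (?\<tau> s) = s" for s
    by (simp add: image_image)
  have mem: "k \<in> ?\<tau> s" if "j \<in> s" for s
    using that by (auto intro!: image_eqI[of _ _ j])
  have mem': "j \<in> ?\<tau> s" if "k \<in> s" for s
    using that by (auto intro!: image_eqI[of _ _ k])
  show ?thesis
    by (rule sum.reindex_bij_witness[of _ ?\<tau> ?\<tau>])
      (use inv sub mem mem' card_\<tau> in auto)
qed

text \<open>By symmetry all coordinates are selected with the same probability, and these \<open>N\<close> probabilities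
add up to the expected number of selected coordinates. This argument avoids the quotient of
binomial coefficients \<open>(N - 1 choose t - 1) / (N choose t) = t / N\<close>.\<close>

lemma (in prob_space) uniform_random_subset_prob_mem:
  assumes U: "uniform_random_subset M N T S" and j: "j < N"
  shows "real N * prob {x \<in> space M. j \<in> S x} = expectation (\<lambda>x. real (T x))"
proof -
  have S: "S \<in> measurable M (count_space (Pow {..<N}))"
    and card_S: "\<And>x. x \<in> space M \<Longrightarrow> card (S x) = T x"
    using U by (auto simp: uniform_random_subset_def)
  have S_sub: "S x \<subseteq> {..<N}" if "x \<in> space M" for x
    using measurable_space[OF S that] by simp
  have S_event: "{x \<in> space M. P (S x)} \<in> events" for P
    by (rule measurable_count_space_Collect[OF S])
  define g where "g t = prob {x \<in> space M. T x = t} / real (N choose t)" for t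
  have prob_mem: "prob {x \<in> space M. i \<in> S x} = (\<Sum>s | s \<subseteq> {..<N} \<and> i \<in> s. g (card s))" for i
  proof -
    have fin: "finite {s. s \<subseteq> {..<N} \<and> i \<in> s}"
      by (rule finite_subset[of _ "Pow {..<N}"]) auto
    have "{x \<in> space M. i \<in> S x} = (\<Union>s\<in>{s. s \<subseteq> {..<N} \<and> i \<in> s}. {x \<in> space M. S x = s})"
      using S_sub by auto
    also have "prob \<dots> = (\<Sum>s | s \<subseteq> {..<N} \<and> i \<in> s. prob {x \<in> space M. S x = s})"
      by (rule finite_measure_finite_Union[OF fin])
        (use S_event in \<open>auto simp: disjoint_family_on_def\<close>)
    also have "\<dots> = (\<Sum>s | s \<subseteq> {..<N} \<and> i \<in> s. g (card s))"
      unfolding g_def by (intro sum.cong refl uniform_random_subset_prob_eq[OF U]) auto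
    finally show ?thesis .
  qed
  have "real N * prob {x \<in> space M. j \<in> S x} = (\<Sum>i<N. prob {x \<in> space M. j \<in> S x})"
    by simp
  also have "\<dots> = (\<Sum>i<N. prob {x \<in> space M. i \<in> S x})"
    unfolding prob_mem using j by (intro sum.cong refl sum_subsets_containing_card_eq) auto
  also have "\<dots> = (\<Sum>i<N. expectation (indicat_real {x \<in> space M. i \<in> S x}))"
    using S_event by simp
  also have "\<dots> = expectation (\<lambda>x. \<Sum>i<N. indicat_real {x \<in> space M. i \<in> S x} x)"
    by (rule Bochner_Integration.integral_sum[symmetric])
      (use S_event in \<open>auto intro!: integrable_real_indicator simp: emeasure_eq_measure\<close>)
  also have "\<dots> = expectation (\<lambda>x. real (T x))"
  proof (rule Bochner_Integration.integral_cong[OF refl])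
    fix x assume x: "x \<in> space M"
    have "(\<Sum>i<N. indicat_real {x \<in> space M. i \<in> S x} x) = (\<Sum>i<N. of_bool (i \<in> S x))"
      using x by (intro sum.cong) auto
    also have "\<dots> = real (card ({..<N} \<inter> S x))"
      by (simp add: of_bool_def sum.If_cases)
    also have "{..<N} \<inter> S x = S x"
      using S_sub[OF x] by auto
    finally show "(\<Sum>i<N. indicat_real {x \<in> space M. i \<in> S x} x) = real (T x)"
      using card_S[OF x] by simp
  qed
  finally show ?thesis .
qed

lemma (in prob_space) uniform_random_subset_expectation_card_pos:
  assumes "uniform_random_subset M N T S"
  shows "0 < expectation (\<lambda>x. real (T x))"
proof -
  have T: "T \<in> measurable M (count_space {1..N})"
    using assms by (simp add: uniform_random_subset_def)
  have range: "1 \<le> T x" "T x \<le> N" if "x \<in> space M" for x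
    using measurable_space[OF T that] by auto
  have "integrable M (\<lambda>x. real (T x))"
    by (rule integrable_const_bound[of _ "real N"])
      (use range in \<open>auto intro!: AE_I2 measurable_compose[OF T]\<close>)
  then have "1 \<le> expectation (\<lambda>x. real (T x))"
    by (rule integral_ge_const) (use range in \<open>auto intro!: AE_I2\<close>)
  then show ?thesis by simp
qed

section \<open>Coordinates of the straggler-tolerant iterates\<close>

text \<open>The condition that \<open>S\<close> is finite comes from the convention that a sum over an infinite set is zero;
keeping it makes the identity valid for every \<open>S\<close>, so that no range condition on the random sets
has to be carried through the recursion.\<close>

lemma D_mat_eq_diagonal:
  "D_mat N S = mat N N (\<lambda>(r, c). of_bool (r = c \<and> finite S \<and> r \<in> S))"
proof (rule eq_matI)
  fix r c
  assume "r < dim_row (mat N N (\<lambda>(r, c). of_bool (r = c \<and> finite S \<and> r \<in> S) :: real))"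
    and "c < dim_col (mat N N (\<lambda>(r, c). of_bool (r = c \<and> finite S \<and> r \<in> S) :: real))"
  then have rc: "r < N" "c < N" by auto
  then have "D_mat N S $$ (r, c) = (\<Sum>j\<in>S. of_bool (r = j) * of_bool (c = j))"
    by (simp add: D_mat_def unit_vec_def of_bool_def)
  also have "\<dots> = (\<Sum>j\<in>S. if j = r then of_bool (r = c) else 0)"
    by (intro sum.cong) auto
  also have "\<dots> = of_bool (r = c \<and> finite S \<and> r \<in> S)"
    by (cases "finite S") auto
  finally show "D_mat N S $$ (r, c) = mat N N (\<lambda>(r, c). of_bool (r = c \<and> finite S \<and> r \<in> S)) $$ (r, c)"
    using rc by simp
qed (auto simp: D_mat_def)

lemma D_mat_mult_vec_index:
  assumes "x \<in> carrier_vec N" "j < N"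
  shows "(D_mat N S *\<^sub>v x) $ j = of_bool (finite S \<and> j \<in> S) * x $ j"
proof -
  have "(D_mat N S *\<^sub>v x) $ j = (\<Sum>k<N. of_bool (j = k \<and> finite S \<and> j \<in> S) * x $ k)"
    using assms by (simp add: D_mat_eq_diagonal scalar_prod_def atLeast0LessThan)
  also have "\<dots> = (\<Sum>k<N. if k = j then of_bool (finite S \<and> j \<in> S) * x $ j else 0)"
    by (intro sum.cong) auto
  also have "\<dots> = of_bool (finite S \<and> j \<in> S) * x $ j"
    using assms(2) by simp
  finally show ?thesis .
qed

lemma straggler_richardson_carrier:
  assumes "v \<in> carrier_vec N" "f \<in> carrier_vec N"
  shows "straggler_richardson N A v \<omega>h \<omega> f Ss m \<in> carrier_vec N"
  using assms by (intro carrier_vecI; cases m) auto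

lemma straggler_richardson_Suc_index:
  fixes Ss :: "nat \<Rightarrow> nat set" and \<omega> \<omega>h :: real
  assumes A: "A \<in> carrier_mat N N" and v: "v \<in> carrier_vec N" and f: "f \<in> carrier_vec N"
    and j: "j < N"
  defines "z \<equiv> straggler_richardson N A v \<omega>h \<omega> f Ss"
  shows "z (Suc m) $ j = z m $ j
    - \<omega>h * (of_bool (finite (Ss (Suc m)) \<and> j \<in> Ss (Suc m)) * (\<Sum>k<N. A $$ (j, k) * z m $ k))
    + \<omega> * v $ j"
proof -
  have z: "z m \<in> carrier_vec N"
    unfolding z_def by (rule straggler_richardson_carrier[OF v f])
  have D: "D_mat N (Ss (Suc m)) \<in> carrier_mat N N"
    by (simp add: D_mat_def)
  have DA: "D_mat N (Ss (Suc m)) * A \<in> carrier_mat N N"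
    using D A by simp
  have "z (Suc m) = (1\<^sub>m N - \<omega>h \<cdot>\<^sub>m (D_mat N (Ss (Suc m)) * A)) *\<^sub>v z m + \<omega> \<cdot>\<^sub>v v"
    by (simp add: z_def)
  also have "\<dots> = z m - \<omega>h \<cdot>\<^sub>v (D_mat N (Ss (Suc m)) *\<^sub>v (A *\<^sub>v z m)) + \<omega> \<cdot>\<^sub>v v"
    using richardson_matrix_mult_vec[OF DA z] assoc_mult_mat_vec[OF D A z] by simp
  finally have "z (Suc m) = z m - \<omega>h \<cdot>\<^sub>v (D_mat N (Ss (Suc m)) *\<^sub>v (A *\<^sub>v z m)) + \<omega> \<cdot>\<^sub>v v" .
  moreover have "(A *\<^sub>v z m) $ j = (\<Sum>k<N. A $$ (j, k) * z m $ k)"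
    using A z j by (simp add: scalar_prod_def atLeast0LessThan)
  moreover have "(D_mat N (Ss (Suc m)) *\<^sub>v (A *\<^sub>v z m)) $ j =
      of_bool (finite (Ss (Suc m)) \<and> j \<in> Ss (Suc m)) * (A *\<^sub>v z m) $ j"
    using A z by (intro D_mat_mult_vec_index j) simp
  ultimately show ?thesis
    using z v j D by (simp del: index_mult_mat_vec)
qed

lemma straggler_richardson_cong:
  assumes "\<And>i. i \<in> {1..m} \<Longrightarrow> Ss i = Ss' i"
  shows "straggler_richardson N A v \<omega>h \<omega> f Ss m = straggler_richardson N A v \<omega>h \<omega> f Ss' m"
  using assms by (induction m) auto

text \<open>Here the iterate is a function on the product space of the first \<open>k\<close> draws, the form in which
independence of disjoint blocks of draws can be applied to it.\<close>

lemma measurable_straggler_richardson: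
  assumes A: "A \<in> carrier_mat N N" and v: "v \<in> carrier_vec N" and f: "f \<in> carrier_vec N"
    and "m \<le> k" and "j < N"
  shows "(\<lambda>w. straggler_richardson N A v \<omega>h \<omega> f (\<lambda>i. snd (w i)) m $ j)
    \<in> borel_measurable (Pi\<^sub>M {1..k} (\<lambda>_. pair_space N))"
  using assms(4,5)
proof (induction m arbitrary: j)
  case 0
  then show ?case by simp
next
  case (Suc m)
  have comp: "(\<lambda>w. w (Suc m)) \<in> measurable (Pi\<^sub>M {1..k} (\<lambda>_. pair_space N)) (pair_space N)"
    using Suc.prems by (intro measurable_component_singleton) auto
  have "(\<lambda>w. of_bool (finite (snd (w (Suc m))) \<and> j \<in> snd (w (Suc m))) :: real)
      \<in> borel_measurable (Pi\<^sub>M {1..k} (\<lambda>_. pair_space N))"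
    by (rule measurable_compose[OF comp]) (simp add: pair_space_def)
  moreover have "(\<lambda>w. straggler_richardson N A v \<omega>h \<omega> f (\<lambda>i. snd (w i)) m $ i)
    \<in> borel_measurable (Pi\<^sub>M {1..k} (\<lambda>_. pair_space N))" if "i < N" for i
    using Suc.IH[of i] Suc.prems that by simp
  ultimately show ?case
    unfolding straggler_richardson_Suc_index[OF A v f Suc.prems(2)]
    using Suc.prems(2) by (intro borel_measurable_add borel_measurable_diff borel_measurable_times
        borel_measurable_sum borel_measurable_const) auto
qed

section \<open>Expectation of the iterates\<close>

lemma (in prob_space) iid_copies_prob_mem:
  assumes U: "uniform_random_subset M N T S" and iid: "iid_copies M N T S Ts Ss" and i: "1 \<le> i"
  shows "prob {x \<in> space M. finite (Ss i x) \<and> j \<in> Ss i x} = prob {x \<in> space M. j \<in> S x}"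
    and "{x \<in> space M. finite (Ss i x) \<and> j \<in> Ss i x} \<in> events"
proof -
  have T: "T \<in> measurable M (count_space {1..N})"
    and S: "S \<in> measurable M (count_space (Pow {..<N}))"
    using U by (auto simp: uniform_random_subset_def)
  have distr: "distr M (pair_space N) (\<lambda>x. (Ts i x, Ss i x)) = distr M (pair_space N) (\<lambda>x. (T x, S x))"
    and "indep_vars (\<lambda>i. pair_space N) (\<lambda>i x. (Ts i x, Ss i x)) {1..}"
    using iid i by (auto simp: iid_copies_def)
  then have copy: "(\<lambda>x. (Ts i x, Ss i x)) \<in> measurable M (pair_space N)"
    using i by (auto simp: indep_vars_def)
  have orig: "(\<lambda>x. (T x, S x)) \<in> measurable M (pair_space N)"
  proof -
    have "(\<lambda>x. (T x, S x)) \<in> measurable M (count_space {1..N} \<Otimes>\<^sub>M count_space (Pow {..<N}))"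
      using T S by simp
    then show ?thesis
      by (simp add: pair_space_def pair_measure_countable countable_finite)
  qed
  define E where "E = {p \<in> space (pair_space N). finite (snd p) \<and> j \<in> snd p}"
  \<comment> \<open>Equality of laws transfers the probability of this one event from the original pair to its copy.\<close>
  have E: "E \<in> sets (pair_space N)"
    by (auto simp: E_def pair_space_def)
  have copy_E: "(\<lambda>x. (Ts i x, Ss i x)) -` E \<inter> space M = {x \<in> space M. finite (Ss i x) \<and> j \<in> Ss i x}"
    using measurable_space[OF copy] by (auto simp: E_def)
  have "S x \<subseteq> {..<N}" if "x \<in> space M" for x
    using measurable_space[OF S that] by simp
  then have orig_E: "(\<lambda>x. (T x, S x)) -` E \<inter> space M = {x \<in> space M. j \<in> S x}"
    using measurable_space[OF orig] finite_subset[of _ "{..<N}"] by (auto simp: E_def)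
  show "prob {x \<in> space M. finite (Ss i x) \<and> j \<in> Ss i x} = prob {x \<in> space M. j \<in> S x}"
    using arg_cong[OF distr, of "\<lambda>D. measure D E"]
    by (simp add: measure_distr[OF copy E] measure_distr[OF orig E] copy_E orig_E)
  show "{x \<in> space M. finite (Ss i x) \<and> j \<in> Ss i x} \<in> events"
    using measurable_sets[OF copy E] copy_E by simp
qed

text \<open>The \<open>m\<close>th iterate is a function of the draws \<open>1, \<dots>, m\<close>, whereas the selection of a coordinate in
the next step is a function of draw \<open>Suc m\<close>.\<close>

lemma (in prob_space) straggler_richardson_indep_next_subset:
  assumes iid: "iid_copies M N T S Ts Ss"
    and A: "A \<in> carrier_mat N N" and v: "v \<in> carrier_vec N" and f: "f \<in> carrier_vec N"
  shows "indep_var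
    borel (\<lambda>x. of_bool (finite (Ss (Suc m) x) \<and> j \<in> Ss (Suc m) x) :: real)
    borel (\<lambda>x. \<Sum>k<N. a k * straggler_richardson N A v \<omega>h \<omega> f (\<lambda>i. Ss i x) m $ k)"
proof -
  let ?X = "\<lambda>i x. (Ts i x, Ss i x)"
  define next_mem :: "(nat \<Rightarrow> nat \<times> nat set) \<Rightarrow> real"
    where "next_mem w = of_bool (finite (snd (w (Suc m))) \<and> j \<in> snd (w (Suc m)))" for w
  define past :: "(nat \<Rightarrow> nat \<times> nat set) \<Rightarrow> real"
    where "past w = (\<Sum>k<N. a k * straggler_richardson N A v \<omega>h \<omega> f (\<lambda>i. snd (w i)) m $ k)" for w
  have "indep_vars (\<lambda>i. pair_space N) ?X {1..}"
    using iid by (simp add: iid_copies_def)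
  then have "indep_var (Pi\<^sub>M {Suc m} (\<lambda>_. pair_space N)) (\<lambda>x. restrict (\<lambda>i. ?X i x) {Suc m})
      (Pi\<^sub>M {1..m} (\<lambda>_. pair_space N)) (\<lambda>x. restrict (\<lambda>i. ?X i x) {1..m})"
    by (rule indep_var_restrict) auto
  moreover have "next_mem \<in> borel_measurable (Pi\<^sub>M {Suc m} (\<lambda>_. pair_space N))"
    unfolding next_mem_def
    by (rule measurable_compose[OF measurable_component_singleton]) (auto simp: pair_space_def)
  moreover have "past \<in> borel_measurable (Pi\<^sub>M {1..m} (\<lambda>_. pair_space N))"
    unfolding past_def
    by (intro borel_measurable_sum borel_measurable_times measurable_straggler_richardson[OF A v f]) auto
  ultimately have "indep_var borel (next_mem \<circ> (\<lambda>x. restrict (\<lambda>i. ?X i x) {Suc m}))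
      borel (past \<circ> (\<lambda>x. restrict (\<lambda>i. ?X i x) {1..m}))"
    by (rule indep_var_compose)
  moreover have "straggler_richardson N A v \<omega>h \<omega> f (\<lambda>i. snd (restrict (\<lambda>i. ?X i x) {1..m} i)) m =
      straggler_richardson N A v \<omega>h \<omega> f (\<lambda>i. Ss i x) m" for x
    by (rule straggler_richardson_cong) simp
  ultimately show ?thesis
    by (simp add: next_mem_def past_def comp_def)
qed

text \<open>Independence lets the expectation of the product of the selection indicator with a coordinate of
\<open>A z\<close> factor. The indicator has mean \<open>E[T] / N\<close>, and this is exactly what the factor
\<open>N / E[T]\<close> in \<open>\<omega>h\<close> cancels, leaving \<open>\<omega>\<close>. Integrability is part of the conclusion because it is
what the induction over \<open>m\<close> passes on; it too comes from independence.\<close>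

lemma (in prob_space) expectation_straggler_richardson_step:
  assumes U: "uniform_random_subset M N T S" and iid: "iid_copies M N T S Ts Ss"
    and A: "A \<in> carrier_mat N N" and v: "v \<in> carrier_vec N" and f: "f \<in> carrier_vec N"
    and \<omega>h: "\<omega>h = real N / expectation (\<lambda>x. real (T x)) * \<omega>"
    and j: "j < N"
  defines "z \<equiv> \<lambda>m x. straggler_richardson N A v \<omega>h \<omega> f (\<lambda>i. Ss i x) m"
  assumes int: "\<And>k. k < N \<Longrightarrow> integrable M (\<lambda>x. z m x $ k)"
  shows "integrable M (\<lambda>x. z (Suc m) x $ j)"
    and "expectation (\<lambda>x. z (Suc m) x $ j) = expectation (\<lambda>x. z m x $ j)
      - \<omega> * (\<Sum>k<N. A $$ (j, k) * expectation (\<lambda>x. z m x $ k)) + \<omega> * v $ j"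
proof -
  define I :: "'a \<Rightarrow> real" where "I x = of_bool (finite (Ss (Suc m) x) \<and> j \<in> Ss (Suc m) x)" for x
  define Y where "Y x = (\<Sum>k<N. A $$ (j, k) * z m x $ k)" for x
  define ev where "ev = {x \<in> space M. finite (Ss (Suc m) x) \<and> j \<in> Ss (Suc m) x}"
  have ev: "prob ev = prob {x \<in> space M. j \<in> S x}" "ev \<in> events"
    unfolding ev_def using iid_copies_prob_mem[OF U iid, of "Suc m" j] by simp_all
  have I_ind: "I x = indicat_real ev x" if "x \<in> space M" for x
    using that by (simp add: I_def ev_def indicator_def)
  have int_I: "integrable M I"
    using ev(2) by (subst Bochner_Integration.integrable_cong[OF refl I_ind])
      (auto simp: emeasure_eq_measure)
  have E_I: "expectation I = prob {x \<in> space M. j \<in> S x}"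
    using ev by (subst Bochner_Integration.integral_cong[OF refl I_ind]) auto
  have int_Y: "integrable M Y"
    unfolding Y_def using int by (intro Bochner_Integration.integrable_sum integrable_mult_right) auto
  have E_Y: "expectation Y = (\<Sum>k<N. A $$ (j, k) * expectation (\<lambda>x. z m x $ k))"
    unfolding Y_def using int by (subst Bochner_Integration.integral_sum) auto
  have indep: "indep_var borel I borel Y"
    unfolding I_def Y_def z_def by (rule straggler_richardson_indep_next_subset[OF iid A v f])
  have int_IY: "integrable M (\<lambda>x. I x * Y x)"
    by (rule indep_var_integrable[OF indep int_I int_Y])
  have E_IY: "expectation (\<lambda>x. I x * Y x) = expectation I * expectation Y"
    by (rule indep_var_lebesgue_integral[OF indep int_I int_Y])
  have step: "z (Suc m) x $ j = z m x $ j - \<omega>h * (I x * Y x) + \<omega> * v $ j" for x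
    unfolding z_def I_def Y_def by (rule straggler_richardson_Suc_index[OF A v f j])
  show "integrable M (\<lambda>x. z (Suc m) x $ j)"
    unfolding step using int[OF j] int_IY by simp
  have "\<omega>h * expectation I = \<omega>"
    using uniform_random_subset_prob_mem[OF U j] uniform_random_subset_expectation_card_pos[OF U] j
    by (simp add: \<omega>h E_I field_simps)
  moreover have "expectation (\<lambda>x. z (Suc m) x $ j) =
      expectation (\<lambda>x. z m x $ j) - \<omega>h * (expectation I * expectation Y) + \<omega> * v $ j"
    unfolding step using int[OF j] int_IY by (simp add: E_IY prob_space)
  ultimately show "expectation (\<lambda>x. z (Suc m) x $ j) = expectation (\<lambda>x. z m x $ j)
      - \<omega> * (\<Sum>k<N. A $$ (j, k) * expectation (\<lambda>x. z m x $ k)) + \<omega> * v $ j"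
    by (simp add: E_Y flip: mult.assoc)
qed

lemma (in prob_space) expectation_straggler_richardson_Suc:
  assumes U: "uniform_random_subset M N T S" and iid: "iid_copies M N T S Ts Ss"
    and A: "A \<in> carrier_mat N N" and v: "v \<in> carrier_vec N" and f: "f \<in> carrier_vec N"
    and \<omega>h: "\<omega>h = real N / expectation (\<lambda>x. real (T x)) * \<omega>"
  defines "u \<equiv> \<lambda>m. expectation_vec M N (\<lambda>x. straggler_richardson N A v \<omega>h \<omega> f (\<lambda>i. Ss i x) m)"
  shows "u (Suc m) = (1\<^sub>m N - \<omega> \<cdot>\<^sub>m A) *\<^sub>v u m + \<omega> \<cdot>\<^sub>v v"
proof -
  note step = expectation_straggler_richardson_step[OF U iid A v f \<omega>h]
  have int: "integrable M (\<lambda>x. straggler_richardson N A v \<omega>h \<omega> f (\<lambda>i. Ss i x) m $ j)" if "j < N" for j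
    using that
  proof (induction m arbitrary: j)
    case (Suc m)
    show ?case by (rule step(1)[OF Suc.prems Suc.IH])
  qed simp
  have um: "u m \<in> carrier_vec N"
    by (simp add: u_def expectation_vec_def)
  have "u (Suc m) = u m - \<omega> \<cdot>\<^sub>v (A *\<^sub>v u m) + \<omega> \<cdot>\<^sub>v v"
  proof (rule eq_vecI)
    fix j assume "j < dim_vec (u m - \<omega> \<cdot>\<^sub>v (A *\<^sub>v u m) + \<omega> \<cdot>\<^sub>v v)"
    then have j: "j < N" using v by simp
    have "(A *\<^sub>v u m) $ j = (\<Sum>k<N. A $$ (j, k) * u m $ k)"
      using A um j by (simp add: scalar_prod_def atLeast0LessThan)
    moreover have "u (Suc m) $ j = u m $ j - \<omega> * (\<Sum>k<N. A $$ (j, k) * u m $ k) + \<omega> * v $ j"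
      using step(2)[OF j int] j by (simp add: u_def expectation_vec_def)
    ultimately show "u (Suc m) $ j = (u m - \<omega> \<cdot>\<^sub>v (A *\<^sub>v u m) + \<omega> \<cdot>\<^sub>v v) $ j"
      using A v um j by simp
  qed (use v in \<open>simp add: u_def expectation_vec_def\<close>)
  then show ?thesis
    by (simp add: richardson_matrix_mult_vec[OF A um])
qed

theorem corollary3p7:
  fixes M :: "'a measure" and N :: nat
    and T :: "'a \<Rightarrow> nat" and S :: "'a \<Rightarrow> nat set"
    and Ts :: "nat \<Rightarrow> 'a \<Rightarrow> nat" and Ss :: "nat \<Rightarrow> 'a \<Rightarrow> nat set"
    and A :: "real mat" and v f :: "real vec" and \<omega> \<omega>h :: real
  assumes "prob_space M"
    and "uniform_random_subset M N T S"
    and "iid_copies M N T S Ts Ss"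
    and "A \<in> carrier_mat N N" and "v \<in> carrier_vec N" and "f \<in> carrier_vec N"
    and "richardson_convergent N A \<omega>"
    and "\<omega>h = real N / (\<integral>x. real (T x) \<partial>M) * \<omega>"
  shows "\<exists>z\<in>carrier_vec N. A *\<^sub>v z = v \<and> (\<forall>y\<in>carrier_vec N. A *\<^sub>v y = v \<longrightarrow> y = z) \<and>
    vec_tendsto N
      (\<lambda>m. expectation_vec M N (\<lambda>x. straggler_richardson N A v \<omega>h \<omega> f (\<lambda>i. Ss i x) m)) z"
proof -
  interpret prob_space M by fact
  obtain z where z: "z \<in> carrier_vec N" "A *\<^sub>v z = v"
    and unique: "\<And>y. y \<in> carrier_vec N \<Longrightarrow> A *\<^sub>v y = v \<Longrightarrow> y = z"
    using richardson_convergent_imp_unique_solution[OF assms(4,5,7)] by blast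
  have "vec_tendsto N
      (\<lambda>m. expectation_vec M N (\<lambda>x. straggler_richardson N A v \<omega>h \<omega> f (\<lambda>i. Ss i x) m)) z"
    using expectation_straggler_richardson_Suc[OF assms(2-6,8)]
    by (intro richardson_tendsto_solution[OF assms(4,7) _ z(1)])
      (auto simp: z(2) expectation_vec_def)
  with z unique show ?thesis by blast
qed

end
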